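(* When (OPT) is monotone, the problems (BL) $$\min_{d}\ \|d-\tilde d\|_2^2\quad\text{s.t. } |\mathcal{O}(d)-\tilde f|\le\beta$$ and (BLM) $$\min_{d,\ \delta\ge0}\ \delta\quad\text{s.t. } d\in\mathcal{S}^{\uparrow}(\delta)\ \text{ and }\ \mathcal{O}(d)\ge\tilde f-\beta$$ are equivalent.
   Context: Parametric problem. For a real vector $d\in\mathbb{R}^k$ of problem inputs, (OPT) is the parametric optimization problem $\mathcal{O}(d)=\min_x f(x)$ s.t. $g(x,d)\ge 0$, $x\ge 0$, where $x$ is a vector of real decision variables, $f$ is a real-valued objective function, and $g$ is a function capturing all the constraints on $x$ and $d$ (inequalities between vectors are componentwise). $\mathcal{O}(d)$ also denotes the optimal value. Let $\mathcal{F}(d)=\{x : g(x,d)\ge 0,\ x\ge 0\}$ be the set of feasible solutions. Data. $d^o\in\mathbb{R}^k$ is the original (sensitive) vector, and $\mathcal{F}(d^o)$ is assumed nonempty; $\tilde d\in\mathbb{R}^k$ is a given vector (a privacy-preserving perturbed version of $d^o$); $\tilde f\in\mathbb{R}$ is an approximation of $\mathcal{O}(d^o)$ with $|\mathcal{O}(d^o)-\tilde f|\le\beta^o$ for some $\beta^o>0$; and $\beta\ge\beta^o$ is a parameter. Monotonicity. Let $\mathcal{N}=\{d : \exists x\ge 0 \text{ with } g(x,d)\ge 0 \text{ and } |f(x)-\tilde f|\le\beta\}$. (OPT) is monotone if there exists a concave function $m:\mathbb{R}^k\to\mathbb{R}$ (the proxy function) such that, for all $d^1,d^2\in\mathcal{N}$,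 $m(d^1)\ge m(d^2)$ implies $\mathcal{O}(d^1)\ge\mathcal{O}(d^2)$. Auxiliary problem. With this $m$, for a given $\delta$, $\mathcal{O}^{\uparrow}(\delta)$ is the problem of maximizing $m(d)$ over pairs $(d,x)$ with $x\ge0$, subject to $g(x,d)\ge0$, $|f(x)-\tilde f|\le\beta$ and $\|d-\tilde d\|_2^2\le\delta$. $\mathcal{S}^{\uparrow}(\delta)$ is its set of optimal solutions $(d,x)$; $d\in\mathcal{S}^{\uparrow}(\delta)$ means that $d$ is the $d$-component of some optimal solution $(d,x)$.
   Formalization: Added: the minimum defining O(d) is attained for each d feasible in (BL), and the auxiliary problem has an optimal solution whenever feasible (else false). "Equivalent" means equal optimal values, with each optimum of one problem yielding an optimum of the other at the same value. *)

theory Defs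
  imports "HOL-Analysis.Analysis"
begin

definition feas :: "(real^'n \<Rightarrow> real^'k \<Rightarrow> real^'p) \<Rightarrow> real^'k \<Rightarrow> (real^'n) set" where
  "feas g d = {x. g x d \<ge> 0 \<and> x \<ge> 0}"

text \<open>The optimal value is extended-real: \<open>\<infinity>\<close> if the problem is infeasible, \<open>- \<infinity>\<close> if it is
  unbounded. A constraint such as \<open>\<bar>opt_val f g d - ft\<bar> \<le> \<beta>\<close> with real \<open>ft\<close>, \<open>\<beta>\<close> thus
  forces the optimal value to be finite.\<close>

definition opt_val ::
  "(real^'n \<Rightarrow> real) \<Rightarrow> (real^'n \<Rightarrow> real^'k \<Rightarrow> real^'p) \<Rightarrow> real^'k \<Rightarrow> ereal" where
  "opt_val f g d = (INF x\<in>feas g d. ereal (f x))"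

definition near_inputs ::
  "(real^'n \<Rightarrow> real) \<Rightarrow> (real^'n \<Rightarrow> real^'k \<Rightarrow> real^'p) \<Rightarrow> real \<Rightarrow> real \<Rightarrow> (real^'k) set" where
  "near_inputs f g ft \<beta> = {d. \<exists>x\<ge>0. g x d \<ge> 0 \<and> \<bar>f x - ft\<bar> \<le> \<beta>}"

definition monotone_proxy ::
  "(real^'n \<Rightarrow> real) \<Rightarrow> (real^'n \<Rightarrow> real^'k \<Rightarrow> real^'p) \<Rightarrow> real \<Rightarrow> real \<Rightarrow> (real^'k \<Rightarrow> real) \<Rightarrow> bool" where
  "monotone_proxy f g ft \<beta> m \<longleftrightarrow>
     concave_on UNIV m \<and>
     (\<forall>d1\<in>near_inputs f g ft \<beta>. \<forall>d2\<in>near_inputs f g ft \<beta>.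
        m d1 \<ge> m d2 \<longrightarrow> opt_val f g d1 \<ge> opt_val f g d2)"

definition aux_feas ::
  "(real^'n \<Rightarrow> real) \<Rightarrow> (real^'n \<Rightarrow> real^'k \<Rightarrow> real^'p) \<Rightarrow> real \<Rightarrow> real \<Rightarrow> real^'k \<Rightarrow> real
     \<Rightarrow> ((real^'k) \<times> (real^'n)) set" where
  "aux_feas f g ft \<beta> dt \<delta> =
     {(d, x). x \<ge> 0 \<and> g x d \<ge> 0 \<and> \<bar>f x - ft\<bar> \<le> \<beta> \<and> (norm (d - dt))\<^sup>2 \<le> \<delta>}"

definition aux_sol ::
  "(real^'n \<Rightarrow> real) \<Rightarrow> (real^'n \<Rightarrow> real^'k \<Rightarrow> real^'p) \<Rightarrow> real \<Rightarrow> real \<Rightarrow> real^'k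
     \<Rightarrow> (real^'k \<Rightarrow> real) \<Rightarrow> real \<Rightarrow> ((real^'k) \<times> (real^'n)) set" where
  "aux_sol f g ft \<beta> dt m \<delta> =
     {p. is_arg_max (\<lambda>(d, x). m d) (\<lambda>p. p \<in> aux_feas f g ft \<beta> dt \<delta>) p}"

definition BL_feas ::
  "(real^'n \<Rightarrow> real) \<Rightarrow> (real^'n \<Rightarrow> real^'k \<Rightarrow> real^'p) \<Rightarrow> real \<Rightarrow> real \<Rightarrow> (real^'k) set" where
  "BL_feas f g ft \<beta> = {d. \<bar>opt_val f g d - ereal ft\<bar> \<le> ereal \<beta>}"

definition BLM_feas ::
  "(real^'n \<Rightarrow> real) \<Rightarrow> (real^'n \<Rightarrow> real^'k \<Rightarrow> real^'p) \<Rightarrow> real \<Rightarrow> real \<Rightarrow> real^'k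
     \<Rightarrow> (real^'k \<Rightarrow> real) \<Rightarrow> ((real^'k) \<times> real) set" where
  "BLM_feas f g ft \<beta> dt m =
     {(d, \<delta>). \<delta> \<ge> 0 \<and> d \<in> fst ` aux_sol f g ft \<beta> dt m \<delta> \<and> opt_val f g d \<ge> ereal (ft - \<beta>)}"

definition BL_optimal ::
  "(real^'n \<Rightarrow> real) \<Rightarrow> (real^'n \<Rightarrow> real^'k \<Rightarrow> real^'p) \<Rightarrow> real \<Rightarrow> real \<Rightarrow> real^'k
     \<Rightarrow> real^'k \<Rightarrow> bool" where
  "BL_optimal f g ft \<beta> dt = is_arg_min (\<lambda>d. (norm (d - dt))\<^sup>2) (\<lambda>d. d \<in> BL_feas f g ft \<beta>)"

definition BLM_optimal ::
  "(real^'n \<Rightarrow> real) \<Rightarrow> (real^'n \<Rightarrow> real^'k \<Rightarrow> real^'p) \<Rightarrow> real \<Rightarrow> real \<Rightarrow> real^'k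
     \<Rightarrow> (real^'k \<Rightarrow> real) \<Rightarrow> (real^'k) \<times> real \<Rightarrow> bool" where
  "BLM_optimal f g ft \<beta> dt m = is_arg_min (\<lambda>(d, \<delta>). \<delta>) (\<lambda>p. p \<in> BLM_feas f g ft \<beta> dt m)"

end

theory Submission
  imports Defs
begin

text \<open>Both feasible sets carry the same objective levels. If \<open>(d, \<delta>)\<close> is feasible for (BLM), then
  the witness \<open>x\<close> of \<open>d \<in> S\<^sup>\<up>(\<delta>)\<close> bounds the optimal value at \<open>d\<close> by \<open>ft + \<beta>\<close>, so \<open>d\<close> is
  feasible for (BL), at a level \<open>\<le> \<delta>\<close>. Conversely, for \<open>d\<close> feasible for (BL), a maximizer
  \<open>d'\<close> of the proxy within the ball around \<open>dt\<close> through \<open>d\<close> has, by monotonicity, an optimal value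
  at least that of \<open>d\<close>, so \<open>d'\<close> is feasible for (BLM) at the level of \<open>d\<close>.\<close>

lemma opt_val_le: "x \<in> feas g d \<Longrightarrow> opt_val f g d \<le> ereal (f x)"
  unfolding opt_val_def by (rule INF_lower)

lemma opt_val_attained:
  assumes "is_arg_min f (\<lambda>x. x \<in> feas g d) x"
  shows "opt_val f g d = ereal (f x)"
proof (rule antisym)
  show "opt_val f g d \<le> ereal (f x)"
    using assms by (simp add: is_arg_min_def opt_val_le)
  show "ereal (f x) \<le> opt_val f g d"
    unfolding opt_val_def using assms by (intro INF_greatest) (auto simp: is_arg_min_linorder)
qed

text \<open>An infinite optimal value fails both sides: its distance to \<open>ft\<close> is
  \<infinity>, and it violates one of the two bounds.\<close>

lemma BL_feas_iff:
  "d \<in> BL_feas f g ft \<beta> \<longleftrightarrow> ereal (ft - \<beta>) \<le> opt_val f g d \<and> opt_val f g d \<le> ereal (ft + \<beta>)"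
  unfolding BL_feas_def by (cases "opt_val f g d") (auto simp: abs_le_iff)

lemma near_inputs_iff_aux_feas:
  "d \<in> near_inputs f g ft \<beta> \<longleftrightarrow> (\<exists>x. (d, x) \<in> aux_feas f g ft \<beta> dt ((norm (d - dt))\<^sup>2))"
  by (auto simp: near_inputs_def aux_feas_def)

lemma aux_solD:
  assumes "(d, x) \<in> aux_sol f g ft \<beta> dt m \<delta>"
  shows "(d, x) \<in> aux_feas f g ft \<beta> dt \<delta>"
    and "(e, y) \<in> aux_feas f g ft \<beta> dt \<delta> \<Longrightarrow> m e \<le> m d"
  using assms by (auto simp: aux_sol_def is_arg_max_linorder)

text \<open>Attainment matters at the upper edge: a minimizer has \<open>f x\<close> equal to the
  optimal value, hence in the band, whereas an unattained infimum \<open>ft + \<beta>\<close> would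
  leave every feasible \<open>x\<close> above the band.\<close>

lemma BL_feas_subset_near_inputs:
  assumes "d \<in> BL_feas f g ft \<beta>" and "is_arg_min f (\<lambda>x. x \<in> feas g d) x"
  shows "d \<in> near_inputs f g ft \<beta>"
proof -
  have "\<bar>f x - ft\<bar> \<le> \<beta>"
    using assms(1) by (simp add: BL_feas_iff opt_val_attained[OF assms(2)] abs_le_iff)
  moreover have "x \<in> feas g d"
    using assms(2) by (simp add: is_arg_min_def)
  ultimately show ?thesis
    by (auto simp: near_inputs_def feas_def)
qed

lemma BLM_feas_imp_BL_feas:
  assumes "(d, \<delta>) \<in> BLM_feas f g ft \<beta> dt m"
  shows "d \<in> BL_feas f g ft \<beta>" and "(norm (d - dt))\<^sup>2 \<le> \<delta>"
proof -
  obtain x where "(d, x) \<in> aux_sol f g ft \<beta> dt m \<delta>" and ge: "ereal (ft - \<beta>) \<le> opt_val f g d"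
    using assms by (auto simp: BLM_feas_def)
  then have x: "(d, x) \<in> aux_feas f g ft \<beta> dt \<delta>"
    by (blast dest: aux_solD(1))
  \<comment> \<open>Only the upper half of the band passes from \<open>f x\<close> to the infimum;
    the lower half is the (BLM) constraint \<open>ge\<close>.\<close>
  then have "opt_val f g d \<le> ereal (f x)" and "ereal (f x) \<le> ereal (ft + \<beta>)"
    by (auto simp: aux_feas_def feas_def intro!: opt_val_le)
  then show "d \<in> BL_feas f g ft \<beta>"
    using ge by (auto simp: BL_feas_iff intro: order_trans)
  show "(norm (d - dt))\<^sup>2 \<le> \<delta>"
    using x by (simp add: aux_feas_def)
qed

lemma BL_feas_imp_BLM_feas:
  assumes d: "d \<in> BL_feas f g ft \<beta>"
    and att: "is_arg_min f (\<lambda>x. x \<in> feas g d) x"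
    and aux: "\<And>\<delta>. aux_feas f g ft \<beta> dt \<delta> \<noteq> {} \<Longrightarrow> aux_sol f g ft \<beta> dt m \<delta> \<noteq> {}"
    and mono: "monotone_proxy f g ft \<beta> m"
  shows "\<exists>d'. (d', (norm (d - dt))\<^sup>2) \<in> BLM_feas f g ft \<beta> dt m"
proof -
  let ?\<delta> = "(norm (d - dt))\<^sup>2"
  have dN: "d \<in> near_inputs f g ft \<beta>"
    using BL_feas_subset_near_inputs[OF d att] .
  then obtain y where y: "(d, y) \<in> aux_feas f g ft \<beta> dt ?\<delta>"
    using near_inputs_iff_aux_feas by blast
  with aux obtain d' x' where sol: "(d', x') \<in> aux_sol f g ft \<beta> dt m ?\<delta>"
    by fastforce
  \<comment> \<open>Monotonicity compares only inputs in \<open>near_inputs\<close>; for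
    \<open>d'\<close> the auxiliary solution \<open>x'\<close> is the witness.\<close>
  have "d' \<in> near_inputs f g ft \<beta>"
    using aux_solD(1)[OF sol] by (auto simp: near_inputs_def aux_feas_def)
  with dN mono aux_solD(2)[OF sol y] have "opt_val f g d \<le> opt_val f g d'"
    by (simp add: monotone_proxy_def)
  with d have "ereal (ft - \<beta>) \<le> opt_val f g d'"
    by (auto simp: BL_feas_iff)
  with sol show ?thesis
    by (force simp: BLM_feas_def)
qed

theorem theorem3:
  fixes f :: "real^'n \<Rightarrow> real"
    and g :: "real^'n \<Rightarrow> real^'k \<Rightarrow> real^'p"
    and d0 dt :: "real^'k"
    and ft \<beta>0 \<beta> :: real
    and m :: "real^'k \<Rightarrow> real"
  assumes "feas g d0 \<noteq> {}"
    and "\<bar>opt_val f g d0 - ereal ft\<bar> \<le> ereal \<beta>0"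
    and "\<beta>0 > 0"
    and "\<beta> \<ge> \<beta>0"
    and OPT_attained: "\<forall>d\<in>BL_feas f g ft \<beta>. \<exists>x. is_arg_min f (\<lambda>x. x \<in> feas g d) x"
    and aux_attained: "\<forall>\<delta>. aux_feas f g ft \<beta> dt \<delta> \<noteq> {} \<longrightarrow> aux_sol f g ft \<beta> dt m \<delta> \<noteq> {}"
    and "monotone_proxy f g ft \<beta> m"
  shows "(INF d\<in>BL_feas f g ft \<beta>. ereal ((norm (d - dt))\<^sup>2))
           = (INF (d, \<delta>)\<in>BLM_feas f g ft \<beta> dt m. ereal \<delta>)
       \<and> (\<forall>d \<delta>. BLM_optimal f g ft \<beta> dt m (d, \<delta>) \<longleftrightarrow>
             BL_optimal f g ft \<beta> dt d \<and> \<delta> = (norm (d - dt))\<^sup>2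
               \<and> d \<in> fst ` aux_sol f g ft \<beta> dt m \<delta>)
       \<and> (\<forall>d. BL_optimal f g ft \<beta> dt d \<longrightarrow>
             (\<exists>d'. BLM_optimal f g ft \<beta> dt m (d', (norm (d - dt))\<^sup>2)))"
proof (intro conjI allI impI iffI)
  let ?BL = "BL_feas f g ft \<beta>" and ?BLM = "BLM_feas f g ft \<beta> dt m"
  have BLM: "\<exists>d'. (d', (norm (d - dt))\<^sup>2) \<in> ?BLM" if "d \<in> ?BL" for d
    using that OPT_attained aux_attained assms(7) BL_feas_imp_BLM_feas by metis
  have BL_opt: "BL_optimal f g ft \<beta> dt d \<longleftrightarrow>
      d \<in> ?BL \<and> (\<forall>e\<in>?BL. (norm (d - dt))\<^sup>2 \<le> (norm (e - dt))\<^sup>2)" for d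
    by (auto simp: BL_optimal_def is_arg_min_linorder)
  have BLM_opt: "BLM_optimal f g ft \<beta> dt m (d, \<delta>) \<longleftrightarrow>
      (d, \<delta>) \<in> ?BLM \<and> (\<forall>(e, \<eta>)\<in>?BLM. \<delta> \<le> \<eta>)" for d \<delta>
    by (auto simp: BLM_optimal_def is_arg_min_linorder)
  \<comment> \<open>\<open>e\<close> is feasible for (BL), so its squared distance lies between the
    (BL) minimum and \<open>\<eta>\<close>.\<close>
  have BLM_lower: "(norm (d - dt))\<^sup>2 \<le> \<eta>" if "BL_optimal f g ft \<beta> dt d" "(e, \<eta>) \<in> ?BLM" for d e \<eta>
    using that BLM_feas_imp_BL_feas[OF that(2)] BL_opt order_trans by blast
  show "(INF d\<in>?BL. ereal ((norm (d - dt))\<^sup>2)) = (INF (d, \<delta>)\<in>?BLM. ereal \<delta>)"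
  proof (rule antisym)
    \<comment> \<open>A (BLM) pair is sent to its first component, which cannot raise the level; a
      (BL) point is sent to a proxy maximizer at the same level.\<close>
    show "(INF d\<in>?BL. ereal ((norm (d - dt))\<^sup>2)) \<le> (INF (d, \<delta>)\<in>?BLM. ereal \<delta>)"
      by (rule INF_mono) (force dest: BLM_feas_imp_BL_feas)
    show "(INF (d, \<delta>)\<in>?BLM. ereal \<delta>) \<le> (INF d\<in>?BL. ereal ((norm (d - dt))\<^sup>2))"
      by (rule INF_mono) (use BLM in force)
  qed
  \<comment> \<open>\<open>d\<close> itself need not maximize the proxy on its ball, so the optimal
    pair may carry another input \<open>d'\<close>.\<close>
  show "\<exists>d'. BLM_optimal f g ft \<beta> dt m (d', (norm (d - dt))\<^sup>2)"
    if "BL_optimal f g ft \<beta> dt d" for d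
    using that BLM[of d] BLM_lower[OF that] unfolding BLM_opt BL_opt by blast
  show "BLM_optimal f g ft \<beta> dt m (d, \<delta>)"
    if "BL_optimal f g ft \<beta> dt d \<and> \<delta> = (norm (d - dt))\<^sup>2 \<and> d \<in> fst ` aux_sol f g ft \<beta> dt m \<delta>" for d \<delta>
  proof -
    have "(d, \<delta>) \<in> ?BLM"
      using that by (auto simp: BL_opt BL_feas_iff BLM_feas_def)
    then show ?thesis
      using that BLM_lower unfolding BLM_opt by blast
  qed
  fix d \<delta>
  assume opt: "BLM_optimal f g ft \<beta> dt m (d, \<delta>)"
  then have feas: "(d, \<delta>) \<in> ?BLM"
    by (simp add: BLM_opt)
  note d = BLM_feas_imp_BL_feas[OF feas]
  \<comment> \<open>Every (BL) point yields a (BLM) pair at its own level, which the least level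
    \<open>\<delta>\<close> cannot exceed; \<open>e = d\<close> then forces equality.\<close>
  have lower: "\<delta> \<le> (norm (e - dt))\<^sup>2" if "e \<in> ?BL" for e
    using opt BLM[OF that] by (auto simp: BLM_opt)
  show "\<delta> = (norm (d - dt))\<^sup>2"
    using d lower by (blast intro: antisym)
  show "BL_optimal f g ft \<beta> dt d"
    using d lower unfolding BL_opt by (blast intro: order_trans)
  show "d \<in> fst ` aux_sol f g ft \<beta> dt m \<delta>"
    using feas by (simp add: BLM_feas_def)
qed

end
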